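(* Let $N$ be a Nijenhuis operator on a Leibniz algebra $(\mathfrak g,[\ ,\ ])$ and $\mathcal B$ a nondegenerate symmetric bilinear form on $\mathfrak g$ satisfying $$\mathcal B(x_2,[x_0,x_1])=-\mathcal B(x_1,[x_0,x_2])+\mathcal B(x_0,[x_1,x_2])+\mathcal B(x_0,[x_2,x_1])\quad\text{for all }x_0,x_1,x_2\in\mathfrak g.$$ If $(\mathcal B,N)$ is a $\mathcal BN$-structure on $\mathfrak g$, then $(\mathcal B^\sharp,S=N^*,N)$ is a dual $\mathcal O$N-structure on $\mathfrak g$ associated to the dual regular representation $(\mathfrak g^*,L^*,-R^*-L^* )$.
   Context: $k$ is a field of characteristic $0$; all vector spaces are finite dimensional over $k$. A (left) Leibniz algebra $(\mathfrak g,[\ ,\ ])$ is a vector space with a bilinear bracket satisfying $[x,[y,z]]=[[x,y],z]+[y,[x,z]]$. A representation $(V,\rho^L,\rho^R)$ of it is a vector space $V$ with linear maps $\rho^L,\rho^R:\mathfrak g\to\mathfrak{gl}(V)$ such that for all $x,y\in\mathfrak g$: $\rho^L([x,y])=[\rho^L(x),\rho^L(y)]$, $\rho^R([x,y])=[\rho^L(x),\rho^R(y)]$ (commutators), and $\rho^R(y)\rho^L(x)=-\rho^R(y)\rho^R(x)$. With $L(x)y=[x,y]=R(y)x$ and $\langle L^*(x)\alpha,y\rangle=-\langle\alpha,L(x)y\rangle$, $\langle R^*(x)\alpha,y\rangle=-\langle\alpha,R(x)y\rangle$, the triple $(\mathfrak g^*,L^*,-L^*-R^* )$ is a representation of $\mathfrak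 g$ (the dual regular representation). $N^*$ is the usual transpose of $N$. A nondegenerate symmetric bilinear form $\mathcal B$ on $\mathfrak g$ induces the isomorphism $\mathcal B^\sharp:\mathfrak g^*\to\mathfrak g$ with $\langle(\mathcal B^\sharp)^{-1}(x),y\rangle=\mathcal B(x,y)$. A Nijenhuis operator on $\mathfrak g$ is a linear endomorphism $N$ with $[N(x),N(y)]=N([N(x),y]+[x,N(y)]-N[x,y])$. $\mathcal BN$-structure: a pair $(\mathcal B,N)$ with $N$ a Nijenhuis operator and $\mathcal B$ a symmetric nondegenerate bilinear form on $\mathfrak g$ such that for all $x_0,x_1,x_2\in\mathfrak g$: $\mathcal B(x_2,[x_0,x_1])=-\mathcal B(x_1,[x_0,x_2])+\mathcal B(x_0,[x_1,x_2])+\mathcal B(x_0,[x_2,x_1])$, $\mathcal B(N(x_0),x_1)=\mathcal B(x_0,N(x_1))$, and $\mathcal B(x_2,N[x_0,x_1])=-\mathcal B(x_1,N[x_0,x_2])+\mathcal B(x_0,N[x_1,x_2])+\mathcal B(x_0,N[x_2,x_1])$. Dual $\mathcal O$N-structure on $\mathfrak g$ associated to a representation $(V,\rho^L,\rho^R)$: a triple $(K,S,N)$ with $K:V\to\mathfrak g$ linear, $S\in\mathfrak{gl}(V)$, $N\in\mathfrak{gl}(\mathfrak g)$ such that: $K$ is an $\mathcal O$-operator, i.e. $[K(u),K(v)]=K([u,v]^K)$ with $[u,v]^K=\rho^L(K(u))v+\rho^R(K(v))u$; $N$ is a Nijenhuis operator and for all $y\in\mathfrak g$, $w\in V$ and each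 $\rho\in\{\rho^L,\rho^R\}$, $\rho(N(y))S(w)=S(\rho(N(y))w)+\rho(y)S^2(w)-S(\rho(y)S(w))$; $NK=KS$; and $\rho^L(NK(w))u+\rho^R(NK(u))w=[S(w),u]^K+[w,S(u)]^K-S[w,u]^K$ for all $w,u\in V$. *)

theory Defs
  imports Complex_Main "HOL-Library.Function_Algebras"
begin

definition finite_dim_subspace ::
    "('k::field \<Rightarrow> 'v::ab_group_add \<Rightarrow> 'v) \<Rightarrow> 'v set \<Rightarrow> bool" where
  "finite_dim_subspace s V \<longleftrightarrow>
     module.subspace s V \<and> (\<exists>B. finite B \<and> module.span s B = V)"

definition linear_on ::
    "('k::field \<Rightarrow> 'v::ab_group_add \<Rightarrow> 'v) \<Rightarrow> ('k \<Rightarrow> 'w::ab_group_add \<Rightarrow> 'w) \<Rightarrow>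
     'v set \<Rightarrow> 'w set \<Rightarrow> ('v \<Rightarrow> 'w) \<Rightarrow> bool" where
  "linear_on s t V W f \<longleftrightarrow>
     (\<forall>v\<in>V. f v \<in> W) \<and>
     (\<forall>u\<in>V. \<forall>v\<in>V. f (u + v) = f u + f v) \<and>
     (\<forall>c. \<forall>v\<in>V. f (s c v) = t c (f v))"


locale leibniz_algebra = vector_space scale
  for scale :: "'k::field_char_0 \<Rightarrow> 'g::ab_group_add \<Rightarrow> 'g" +
  fixes bracket :: "'g \<Rightarrow> 'g \<Rightarrow> 'g"
  assumes finite_dim: "finite_dim_subspace scale UNIV"
    and linear_bracket_left: "Vector_Spaces.linear scale scale (\<lambda>x. bracket x y)"
    and linear_bracket_right: "Vector_Spaces.linear scale scale (\<lambda>y. bracket x y)"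
    and left_leibniz:
      "bracket x (bracket y z) = bracket (bracket x y) z + bracket y (bracket x z)"

text \<open>The representation space is a subspace \<open>V\<close> of an ambient vector space, so that it can be the
  set of linear functionals inside the space of all functions. The maps \<open>rhoL x\<close> and \<open>rhoR x\<close>
  matter only on \<open>V\<close>.\<close>

locale leibniz_representation =
  leibniz_algebra scale bracket + amb: vector_space scaleV
  for scale :: "'k::field_char_0 \<Rightarrow> 'g::ab_group_add \<Rightarrow> 'g"
    and bracket :: "'g \<Rightarrow> 'g \<Rightarrow> 'g"
    and scaleV :: "'k \<Rightarrow> 'v::ab_group_add \<Rightarrow> 'v" +
  fixes V :: "'v set" and rhoL rhoR :: "'g \<Rightarrow> 'v \<Rightarrow> 'v"
  assumes finite_dim_V: "finite_dim_subspace scaleV V"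
    and rhoL_endo: "linear_on scaleV scaleV V V (rhoL x)"
    and rhoR_endo: "linear_on scaleV scaleV V V (rhoR x)"
    and rhoL_linear: "v \<in> V \<Longrightarrow> Vector_Spaces.linear scale scaleV (\<lambda>x. rhoL x v)"
    and rhoR_linear: "v \<in> V \<Longrightarrow> Vector_Spaces.linear scale scaleV (\<lambda>x. rhoR x v)"
    and rhoL_bracket:
      "v \<in> V \<Longrightarrow> rhoL (bracket x y) v = rhoL x (rhoL y v) - rhoL y (rhoL x v)"
    and rhoR_bracket:
      "v \<in> V \<Longrightarrow> rhoR (bracket x y) v = rhoL x (rhoR y v) - rhoR y (rhoL x v)"
    and rhoR_rhoL: "v \<in> V \<Longrightarrow> rhoR y (rhoL x v) = - rhoR y (rhoR x v)"


definition dual_space :: "('k::field \<Rightarrow> 'g::ab_group_add \<Rightarrow> 'g) \<Rightarrow> ('g \<Rightarrow> 'k) set" where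
  "dual_space scale = {\<alpha>. Vector_Spaces.linear scale (*) \<alpha>}"

definition fun_scale :: "'k::field \<Rightarrow> ('g \<Rightarrow> 'k) \<Rightarrow> 'g \<Rightarrow> 'k" where
  "fun_scale c \<alpha> = (\<lambda>x. c * \<alpha> x)"

definition dual_map :: "('g \<Rightarrow> 'g) \<Rightarrow> ('g \<Rightarrow> 'k) \<Rightarrow> 'g \<Rightarrow> 'k" where
  "dual_map f \<alpha> = (\<lambda>y. \<alpha> (f y))"

text \<open>With \<open>L(x) y = [x,y]\<close> and \<open>R(x) y = [y,x]\<close>, the maps \<open>Lstar x\<close> and \<open>Rstar x\<close> are the
  negatives of the transposes of \<open>L(x)\<close> and \<open>R(x)\<close>, whereas \<open>dual_map\<close> carries no sign.\<close>

definition Lstar :: "('g \<Rightarrow> 'g \<Rightarrow> 'g) \<Rightarrow> 'g \<Rightarrow> ('g \<Rightarrow> 'k::field) \<Rightarrow> 'g \<Rightarrow> 'k" where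
  "Lstar bracket x \<alpha> = (\<lambda>y. - \<alpha> (bracket x y))"

definition Rstar :: "('g \<Rightarrow> 'g \<Rightarrow> 'g) \<Rightarrow> 'g \<Rightarrow> ('g \<Rightarrow> 'k::field) \<Rightarrow> 'g \<Rightarrow> 'k" where
  "Rstar bracket x \<alpha> = (\<lambda>y. - \<alpha> (bracket y x))"


definition nondegenerate_symmetric_form ::
    "('k::field \<Rightarrow> 'g::ab_group_add \<Rightarrow> 'g) \<Rightarrow> ('g \<Rightarrow> 'g \<Rightarrow> 'k) \<Rightarrow> bool" where
  "nondegenerate_symmetric_form scale B \<longleftrightarrow>
     (\<forall>x. Vector_Spaces.linear scale (*) (\<lambda>y. B x y)) \<and>
     (\<forall>y. Vector_Spaces.linear scale (*) (\<lambda>x. B x y)) \<and>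
     (\<forall>x y. B x y = B y x) \<and>
     (\<forall>x. (\<forall>y. B x y = 0) \<longrightarrow> x = 0)"

text \<open>The curried form \<open>B\<close> is itself the map \<open>x \<mapsto> B(x,-)\<close>, which for nondegenerate \<open>B\<close> in finite
  dimension is a bijection from the whole type onto \<open>dual_space scale\<close>. The values of \<open>sharp B\<close>
  at functions outside the dual space are irrelevant.\<close>

definition sharp :: "('g \<Rightarrow> 'g \<Rightarrow> 'k) \<Rightarrow> ('g \<Rightarrow> 'k) \<Rightarrow> 'g" where
  "sharp B = inv_into UNIV B"


definition nijenhuis_operator ::
    "('k::field \<Rightarrow> 'g::ab_group_add \<Rightarrow> 'g) \<Rightarrow> ('g \<Rightarrow> 'g \<Rightarrow> 'g) \<Rightarrow> ('g \<Rightarrow> 'g) \<Rightarrow> bool" where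
  "nijenhuis_operator scale bracket N \<longleftrightarrow>
     Vector_Spaces.linear scale scale N \<and>
     (\<forall>x y. bracket (N x) (N y) = N (bracket (N x) y + bracket x (N y) - N (bracket x y)))"

definition BN_structure ::
    "('k::field \<Rightarrow> 'g::ab_group_add \<Rightarrow> 'g) \<Rightarrow> ('g \<Rightarrow> 'g \<Rightarrow> 'g) \<Rightarrow>
     ('g \<Rightarrow> 'g \<Rightarrow> 'k) \<Rightarrow> ('g \<Rightarrow> 'g) \<Rightarrow> bool" where
  "BN_structure scale bracket B N \<longleftrightarrow>
     nijenhuis_operator scale bracket N \<and>
     nondegenerate_symmetric_form scale B \<and>
     (\<forall>x0 x1 x2. B x2 (bracket x0 x1) =
        - B x1 (bracket x0 x2) + B x0 (bracket x1 x2) + B x0 (bracket x2 x1)) \<and>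
     (\<forall>x0 x1. B (N x0) x1 = B x0 (N x1)) \<and>
     (\<forall>x0 x1 x2. B x2 (N (bracket x0 x1)) =
        - B x1 (N (bracket x0 x2)) + B x0 (N (bracket x1 x2)) + B x0 (N (bracket x2 x1)))"


definition K_bracket ::
    "('g \<Rightarrow> 'v \<Rightarrow> 'v::ab_group_add) \<Rightarrow> ('g \<Rightarrow> 'v \<Rightarrow> 'v) \<Rightarrow> ('v \<Rightarrow> 'g) \<Rightarrow> 'v \<Rightarrow> 'v \<Rightarrow> 'v" where
  "K_bracket rhoL rhoR K u v = rhoL (K u) v + rhoR (K v) u"

definition O_operator ::
    "('k::field \<Rightarrow> 'g::ab_group_add \<Rightarrow> 'g) \<Rightarrow> ('g \<Rightarrow> 'g \<Rightarrow> 'g) \<Rightarrow>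
     ('k \<Rightarrow> 'v::ab_group_add \<Rightarrow> 'v) \<Rightarrow> 'v set \<Rightarrow>
     ('g \<Rightarrow> 'v \<Rightarrow> 'v) \<Rightarrow> ('g \<Rightarrow> 'v \<Rightarrow> 'v) \<Rightarrow> ('v \<Rightarrow> 'g) \<Rightarrow> bool" where
  "O_operator scale bracket scaleV V rhoL rhoR K \<longleftrightarrow>
     linear_on scaleV scale V UNIV K \<and>
     (\<forall>u\<in>V. \<forall>v\<in>V. bracket (K u) (K v) = K (K_bracket rhoL rhoR K u v))"

definition dual_ON_structure ::
    "('k::field_char_0 \<Rightarrow> 'g::ab_group_add \<Rightarrow> 'g) \<Rightarrow> ('g \<Rightarrow> 'g \<Rightarrow> 'g) \<Rightarrow>
     ('k \<Rightarrow> 'v::ab_group_add \<Rightarrow> 'v) \<Rightarrow> 'v set \<Rightarrow>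
     ('g \<Rightarrow> 'v \<Rightarrow> 'v) \<Rightarrow> ('g \<Rightarrow> 'v \<Rightarrow> 'v) \<Rightarrow>
     ('v \<Rightarrow> 'g) \<Rightarrow> ('v \<Rightarrow> 'v) \<Rightarrow> ('g \<Rightarrow> 'g) \<Rightarrow> bool" where
  "dual_ON_structure scale bracket scaleV V rhoL rhoR K S N \<longleftrightarrow>
     leibniz_representation scale bracket scaleV V rhoL rhoR \<and>
     O_operator scale bracket scaleV V rhoL rhoR K \<and>
     linear_on scaleV scaleV V V S \<and>
     nijenhuis_operator scale bracket N \<and>
     (\<forall>\<rho>\<in>{rhoL, rhoR}. \<forall>y. \<forall>w\<in>V.
        \<rho> (N y) (S w) = S (\<rho> (N y) w) + \<rho> y (S (S w)) - S (\<rho> y (S w))) \<and>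
     (\<forall>w\<in>V. N (K w) = K (S w)) \<and>
     (\<forall>w\<in>V. \<forall>u\<in>V.
        rhoL (N (K w)) u + rhoR (N (K u)) w =
          K_bracket rhoL rhoR K (S w) u + K_bracket rhoL rhoR K w (S u)
          - S (K_bracket rhoL rhoR K w u))"

end

theory Submission imports Defs begin

text \<open>For \<open>a\<close> in \<open>\<gg>\<close> let \<open>B a = B(a,-)\<close> be the corresponding functional. Since \<open>\<gg>\<close> is finite
  dimensional and \<open>B\<close> is nondegenerate, every functional has this form, so every identity between
  functionals that \<open>sharp B\<close> occurs in can be checked on \<open>\<alpha> = B a\<close> and \<open>\<beta> = B b\<close>, where
  \<open>sharp B\<close> merely removes the letter \<open>B\<close>. Two translations then do all the work:

  \<^item> The invariance condition on \<open>B\<close> says precisely that \<open>\<rho>\<^sup>L(a) (B b) + \<rho>\<^sup>R(b) (B a) = B [a,b]\<close>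
    (\<open>dual_regular_sum_form\<close>). In other words, \<open>B\<close> carries the Leibniz bracket to the bracket that
    \<open>sharp B\<close> induces on functionals, which is why \<open>sharp B\<close> is an \<open>\<O>\<close>-operator.
  \<^item> The symmetry of \<open>N\<close> says that \<open>N\<^sup>* (B a) = B (N a)\<close>, that is, \<open>N K = K S\<close>.

  After these translations the last compatibility condition becomes a statement about \<open>B\<close> alone:
  the invariance condition applied to the arguments \<open>(N a, b)\<close> and to \<open>(a, N b)\<close> leaves a
  remainder, which is exactly the condition relating \<open>B\<close>, \<open>N\<close> and the bracket in a
  \<open>\<B>N\<close>-structure (\<open>dual_regular_sum_form_Nijenhuis\<close>). The compatibility of \<open>N\<close> and \<open>N\<^sup>*\<close>
  with \<open>\<rho>\<^sup>L\<close> and \<open>\<rho>\<^sup>R\<close> does not involve \<open>B\<close>: evaluated at a vector, it is a functional applied to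
  the Nijenhuis identity.\<close>

section \<open>The dual of a finite-dimensional space\<close>

lemma vector_space_fun_scale: "vector_space (fun_scale :: 'k::field \<Rightarrow> ('g \<Rightarrow> 'k) \<Rightarrow> _)"
  by unfold_locales (auto simp: fun_scale_def fun_eq_iff algebra_simps)

lemma vector_space_field: "vector_space ((*) :: 'k::field \<Rightarrow> 'k \<Rightarrow> 'k)"
  by unfold_locales (auto simp: algebra_simps)

lemma linear_iff_additive_homogeneous:
  assumes "vector_space s" "vector_space t"
  shows "Vector_Spaces.linear s t f \<longleftrightarrow>
    (\<forall>x y. f (x + y) = f x + f y) \<and> (\<forall>c x. f (s c x) = t c (f x))"
  using assms
  by (auto simp: Vector_Spaces.linear_def module_hom_iff module_iff_vector_space)

lemma sum_fun_apply: "(\<Sum>i\<in>I. h i) x = (\<Sum>i\<in>I. h i x)"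
  for h :: "'i \<Rightarrow> 'a \<Rightarrow> 'b::ab_group_add"
  by (induction I rule: infinite_finite_induct) auto

context vector_space
begin

lemma dual_space_iff:
  "\<alpha> \<in> dual_space scale \<longleftrightarrow>
    (\<forall>x y. \<alpha> (x + y) = \<alpha> x + \<alpha> y) \<and> (\<forall>c x. \<alpha> (scale c x) = c * \<alpha> x)"
  unfolding dual_space_def
  using linear_iff_additive_homogeneous[OF vector_space_axioms vector_space_field] by simp

lemma dual_space_eval:
  assumes "\<alpha> \<in> dual_space scale"
  shows "\<alpha> (x + y) = \<alpha> x + \<alpha> y" "\<alpha> (x - y) = \<alpha> x - \<alpha> y" "\<alpha> (- x) = - \<alpha> x"
    "\<alpha> 0 = 0" "\<alpha> (scale c x) = c * \<alpha> x"
proof -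
  have add: "\<alpha> (x + y) = \<alpha> x + \<alpha> y" for x y
    using assms by (simp add: dual_space_iff)
  show "\<alpha> (x + y) = \<alpha> x + \<alpha> y" by (rule add)
  show "\<alpha> (scale c x) = c * \<alpha> x" using assms by (simp add: dual_space_iff)
  show zero: "\<alpha> 0 = 0" using assms by (metis dual_space_iff mult_zero_left scale_zero_left)
  show "\<alpha> (x - y) = \<alpha> x - \<alpha> y" using add[of "x - y" y] by simp
  show "\<alpha> (- x) = - \<alpha> x" using add[of x "- x"] zero by (simp add: eq_neg_iff_add_eq_0 add.commute)
qed

lemma subspace_dual_space: "module.subspace fun_scale (dual_space scale)"
proof -
  interpret F: vector_space "fun_scale :: 'a \<Rightarrow> ('b \<Rightarrow> 'a) \<Rightarrow> _" by (rule vector_space_fun_scale)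
  show ?thesis
    by (auto simp: F.subspace_def dual_space_iff fun_scale_def algebra_simps)
qed

text \<open>A finite basis of the space has a coordinate functional for each of its elements, and these
  functionals span the dual.\<close>

lemma dual_space_spanned_by_coordinates:
  assumes "finite_dim_subspace scale UNIV"
  obtains E D where "finite E" "independent E" "span E = UNIV"
    "finite D" "card D \<le> card E" "module.span fun_scale D = dual_space scale"
proof -
  interpret F: vector_space "fun_scale :: 'a \<Rightarrow> ('b \<Rightarrow> 'a) \<Rightarrow> _" by (rule vector_space_fun_scale)
  obtain G where G: "finite G" "span G = UNIV"
    using assms by (auto simp: finite_dim_subspace_def)
  obtain E where E: "E \<subseteq> G" "independent E" "span G \<subseteq> span E"
    by (metis maximal_independent_subset span_mono span_span)
  have finE: "finite E" using E(1) G(1) by (rule finite_subset)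
  have spE: "span E = UNIV" using E(3) G(2) by auto
  define D where "D = (\<lambda>e x. representation E x e) ` E"
  have "D \<subseteq> dual_space scale"
    by (auto simp: D_def dual_space_iff representation_add[OF E(2)]
        representation_scale[OF E(2)] spE)
  then have "F.span D \<subseteq> dual_space scale"
    using subspace_dual_space by (rule F.span_minimal)
  moreover have "\<alpha> \<in> F.span D" if \<alpha>: "\<alpha> \<in> dual_space scale" for \<alpha>
  proof -
    interpret A: module_hom scale "(*)" \<alpha>
      using \<alpha> unfolding dual_space_def Vector_Spaces.linear_def by simp
    have "\<alpha> = (\<Sum>e\<in>E. fun_scale (\<alpha> e) (\<lambda>x. representation E x e))"
    proof
      fix x
      have "x = (\<Sum>e\<in>E. scale (representation E x e) e)"
        using sum_representation_eq[OF E(2) _ finE order_refl, of x] spE by simp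
      then have "\<alpha> x = \<alpha> (\<Sum>e\<in>E. scale (representation E x e) e)" by (rule arg_cong)
      also have "\<dots> = (\<Sum>e\<in>E. \<alpha> e * representation E x e)"
        by (simp add: A.sum A.scale mult.commute)
      also have "\<dots> = (\<Sum>e\<in>E. fun_scale (\<alpha> e) (\<lambda>x. representation E x e)) x"
        by (simp add: sum_fun_apply fun_scale_def)
      finally show "\<alpha> x = (\<Sum>e\<in>E. fun_scale (\<alpha> e) (\<lambda>x. representation E x e)) x" .
    qed
    also have "\<dots> \<in> F.span D"
      by (intro F.span_sum F.span_scale F.span_base) (auto simp: D_def)
    finally show ?thesis .
  qed
  ultimately have "F.span D = dual_space scale" by auto
  moreover have "finite D" "card D \<le> card E"
    using finE by (auto simp: D_def card_image_le)
  ultimately show thesis using that finE E(2) spE by blast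
qed

lemma finite_dim_dual_space:
  assumes "finite_dim_subspace scale UNIV"
  shows "finite_dim_subspace fun_scale (dual_space scale)"
proof -
  obtain D where "finite D" "module.span fun_scale D = dual_space scale"
    by (rule dual_space_spanned_by_coordinates[OF assms])
  then show ?thesis using subspace_dual_space unfolding finite_dim_subspace_def by blast
qed

lemma nondegenerate_form_eval:
  assumes "nondegenerate_symmetric_form scale B"
  shows "B a \<in> dual_space scale" "B a b = B b a"
    "B (a + b) = B a + B b" "B (a - b) = B a - B b" "B (scale c a) = fun_scale c (B a)"
proof -
  have dual: "B a \<in> dual_space scale" for a
    using assms by (simp add: nondegenerate_symmetric_form_def dual_space_def)
  have sym: "B a b = B b a" for a b
    using assms by (simp add: nondegenerate_symmetric_form_def)
  show "B a \<in> dual_space scale" by (rule dual)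
  show "B a b = B b a" by (rule sym)
  show "B (a + b) = B a + B b" "B (a - b) = B a - B b" "B (scale c a) = fun_scale c (B a)"
    by (simp_all add: fun_eq_iff fun_scale_def sym[of "a + b"] sym[of "a - b"] sym[of "scale c a"]
        sym[of a] sym[of b] dual_space_eval[OF dual])
qed

lemma inj_nondegenerate_form:
  assumes "nondegenerate_symmetric_form scale B"
  shows "inj B"
proof (rule injI)
  fix a b assume "B a = B b"
  then have "\<forall>y. B (a - b) y = 0"
    by (simp add: nondegenerate_form_eval(4)[OF assms])
  then have "a - b = 0" using assms unfolding nondegenerate_symmetric_form_def by blast
  then show "a = b" by simp
qed

text \<open>The image of a basis under the injective linear map \<open>a \<mapsto> B a\<close> is an independent set of
  functionals. A functional outside its span would give one independent functional more than the
  number of coordinate functionals, which span the dual.\<close>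

lemma nondegenerate_form_onto_dual_space:
  assumes fd: "finite_dim_subspace scale UNIV" and B: "nondegenerate_symmetric_form scale B"
  shows "range B = dual_space scale"
proof -
  interpret F: vector_space "fun_scale :: 'a \<Rightarrow> ('b \<Rightarrow> 'a) \<Rightarrow> _" by (rule vector_space_fun_scale)
  obtain E D where E: "finite E" "independent E" "span E = UNIV"
    and D: "finite D" "card D \<le> card E" "F.span D = dual_space scale"
    by (rule dual_space_spanned_by_coordinates[OF fd])
  have "Vector_Spaces.linear scale fun_scale B"
    by (simp add: linear_iff_additive_homogeneous[OF vector_space_axioms vector_space_fun_scale]
        nondegenerate_form_eval(3,5)[OF B])
  then interpret B: Vector_Spaces.linear scale fun_scale B .
  have inj: "inj B" using B by (rule inj_nondegenerate_form)
  have ind: "F.independent (B ` E)"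
    using E inj by (simp add: B.independent_injective_image inj_on_subset)
  have span: "F.span (B ` E) = range B"
    using E(3) B.span_image[of E] by simp
  have "\<alpha> \<in> range B" if "\<alpha> \<in> dual_space scale" for \<alpha>
  proof (rule ccontr)
    assume "\<alpha> \<notin> range B"
    then have \<alpha>: "\<alpha> \<notin> F.span (B ` E)" by (simp add: span)
    then have "F.independent (insert \<alpha> (B ` E))"
      using ind by (simp add: F.independent_insertI)
    moreover have "insert \<alpha> (B ` E) \<subseteq> F.span D"
      using that by (auto simp: D(3) nondegenerate_form_eval[OF B])
    ultimately have "card (insert \<alpha> (B ` E)) \<le> card D"
      using F.independent_span_bound[OF D(1)] by blast
    moreover have "\<alpha> \<notin> B ` E" using \<alpha> F.span_base by blast
    moreover have "card (B ` E) = card E"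
      using inj by (simp add: card_image inj_on_subset)
    ultimately show False using D(2) E(1) by simp
  qed
  then show ?thesis using nondegenerate_form_eval(1)[OF B] by auto
qed

end

section \<open>The dual regular representation\<close>

context leibniz_algebra
begin

lemma bracket_simps:
  "bracket (x + y) z = bracket x z + bracket y z"
  "bracket x (y + z) = bracket x y + bracket x z"
  "bracket (scale c x) y = scale c (bracket x y)"
  "bracket x (scale c y) = scale c (bracket x y)"
  using linear_bracket_left linear_bracket_right
  by (simp_all add: linear_iff_additive_homogeneous[OF vector_space_axioms vector_space_axioms])

text \<open>Left multiplication is a derivation on brackets, so \<open>L([x,y])\<close> and \<open>-L([y,x])\<close> are both the
  commutator of \<open>L(x)\<close> and \<open>L(y)\<close>. This is the source of the axiom
  \<open>\<rho>\<^sup>R(y) \<rho>\<^sup>L(x) = - \<rho>\<^sup>R(y) \<rho>\<^sup>R(x)\<close> in the dual.\<close>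

lemma symmetrized_bracket_acts_trivially: "bracket (bracket x y + bracket y x) z = 0"
  using left_leibniz[of x y z] left_leibniz[of y x z] by (simp add: bracket_simps)

lemma dual_regular_representation:
  "leibniz_representation scale bracket fun_scale (dual_space scale)
     (Lstar bracket) (\<lambda>x \<alpha>. - Rstar bracket x \<alpha> - Lstar bracket x \<alpha>)"
proof (rule leibniz_representation.intro[OF leibniz_algebra_axioms vector_space_fun_scale],
    rule leibniz_representation_axioms.intro)
  show "finite_dim_subspace fun_scale (dual_space scale)"
    using finite_dim by (rule finite_dim_dual_space)
  fix x y :: 'g
  show "linear_on fun_scale fun_scale (dual_space scale) (dual_space scale) (Lstar bracket x)"
    by (auto simp: linear_on_def dual_space_iff Lstar_def fun_scale_def fun_eq_iff bracket_simps)
  show "linear_on fun_scale fun_scale (dual_space scale) (dual_space scale)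
      (\<lambda>\<alpha>. - Rstar bracket x \<alpha> - Lstar bracket x \<alpha>)"
    by (auto simp: linear_on_def dual_space_iff Lstar_def Rstar_def fun_scale_def fun_eq_iff
        bracket_simps algebra_simps)
  fix \<alpha> :: "'g \<Rightarrow> 'k" assume \<alpha>: "\<alpha> \<in> dual_space scale"
  note eval = dual_space_eval[OF \<alpha>]
  note linear_iff = linear_iff_additive_homogeneous[OF vector_space_axioms vector_space_fun_scale]
  show "Vector_Spaces.linear scale fun_scale (\<lambda>x. Lstar bracket x \<alpha>)"
    by (simp add: linear_iff Lstar_def fun_scale_def fun_eq_iff bracket_simps eval)
  show "Vector_Spaces.linear scale fun_scale (\<lambda>x. - Rstar bracket x \<alpha> - Lstar bracket x \<alpha>)"
    by (simp add: linear_iff Lstar_def Rstar_def fun_scale_def fun_eq_iff bracket_simps eval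
        algebra_simps)
  show "Lstar bracket (bracket x y) \<alpha>
      = Lstar bracket x (Lstar bracket y \<alpha>) - Lstar bracket y (Lstar bracket x \<alpha>)"
    by (simp add: Lstar_def fun_eq_iff left_leibniz[of x y] eval)
  show "- Rstar bracket (bracket x y) \<alpha> - Lstar bracket (bracket x y) \<alpha>
      = Lstar bracket x (- Rstar bracket y \<alpha> - Lstar bracket y \<alpha>)
        - (- Rstar bracket y (Lstar bracket x \<alpha>) - Lstar bracket y (Lstar bracket x \<alpha>))"
  proof
    fix z
    show "(- Rstar bracket (bracket x y) \<alpha> - Lstar bracket (bracket x y) \<alpha>) z
      = (Lstar bracket x (- Rstar bracket y \<alpha> - Lstar bracket y \<alpha>)
        - (- Rstar bracket y (Lstar bracket x \<alpha>) - Lstar bracket y (Lstar bracket x \<alpha>))) z"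
      \<comment> \<open>Both terms of \<open>[x, [y,z] + [z,y]]\<close> are expanded by the derivation rule.\<close>
      using left_leibniz[of x y z] left_leibniz[of x z y]
      by (simp add: Lstar_def Rstar_def eval)
  qed
  show "- Rstar bracket y (Lstar bracket x \<alpha>) - Lstar bracket y (Lstar bracket x \<alpha>)
      = - (- Rstar bracket y (- Rstar bracket x \<alpha> - Lstar bracket x \<alpha>)
           - Lstar bracket y (- Rstar bracket x \<alpha> - Lstar bracket x \<alpha>))"
  proof
    fix z
    have "\<alpha> (bracket (bracket z y) x) + \<alpha> (bracket (bracket y z) x) = 0"
      using arg_cong[OF symmetrized_bracket_acts_trivially[of z y x], of \<alpha>]
      by (simp add: bracket_simps eval)
    then show "(- Rstar bracket y (Lstar bracket x \<alpha>) - Lstar bracket y (Lstar bracket x \<alpha>)) z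
      = (- (- Rstar bracket y (- Rstar bracket x \<alpha> - Lstar bracket x \<alpha>)
           - Lstar bracket y (- Rstar bracket x \<alpha> - Lstar bracket x \<alpha>))) z"
      by (simp add: Lstar_def Rstar_def algebra_simps)
  qed
qed

section \<open>Invariant forms and Nijenhuis operators\<close>

text \<open>At a vector \<open>z\<close> each term becomes, up to sign, the functional \<open>\<alpha>\<close> applied to one of the four
  terms of the Nijenhuis identity: for the pair \<open>(y, z)\<close> in the case of \<open>L\<^sup>*\<close>, and for \<open>(z, y)\<close> in the
  case of \<open>R\<^sup>*\<close>.\<close>

lemma dual_map_compatible_with_stars:
  assumes N: "nijenhuis_operator scale bracket N" and \<alpha>: "\<alpha> \<in> dual_space scale"
  shows "Lstar bracket (N y) (dual_map N \<alpha>) = dual_map N (Lstar bracket (N y) \<alpha>)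
      + Lstar bracket y (dual_map N (dual_map N \<alpha>)) - dual_map N (Lstar bracket y (dual_map N \<alpha>))"
    and "Rstar bracket (N y) (dual_map N \<alpha>) = dual_map N (Rstar bracket (N y) \<alpha>)
      + Rstar bracket y (dual_map N (dual_map N \<alpha>)) - dual_map N (Rstar bracket y (dual_map N \<alpha>))"
proof -
  have lin: "Vector_Spaces.linear scale scale N"
    and nij: "bracket (N x) (N y) = N (bracket (N x) y + bracket x (N y) - N (bracket x y))" for x y
    using N by (auto simp: nijenhuis_operator_def)
  interpret N: Vector_Spaces.linear scale scale N by (rule lin)
  note unfold = fun_eq_iff dual_map_def nij N.add N.diff dual_space_eval[OF \<alpha>]
  show "Lstar bracket (N y) (dual_map N \<alpha>) = dual_map N (Lstar bracket (N y) \<alpha>)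
      + Lstar bracket y (dual_map N (dual_map N \<alpha>)) - dual_map N (Lstar bracket y (dual_map N \<alpha>))"
    by (simp add: Lstar_def unfold)
  show "Rstar bracket (N y) (dual_map N \<alpha>) = dual_map N (Rstar bracket (N y) \<alpha>)
      + Rstar bracket y (dual_map N (dual_map N \<alpha>)) - dual_map N (Rstar bracket y (dual_map N \<alpha>))"
    by (simp add: Rstar_def unfold)
qed

lemma linear_on_dual_map:
  assumes "Vector_Spaces.linear scale scale N"
  shows "linear_on fun_scale fun_scale (dual_space scale) (dual_space scale) (dual_map N)"
  using assms
  by (auto simp: linear_iff_additive_homogeneous[OF vector_space_axioms vector_space_axioms]
      linear_on_def dual_space_iff dual_map_def fun_scale_def fun_eq_iff)

text \<open>Evaluated at \<open>y\<close>, this is the invariance condition for \<open>a, b, y\<close>.\<close>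

lemma dual_regular_sum_form:
  assumes "nondegenerate_symmetric_form scale B"
    and "\<forall>x0 x1 x2. B x2 (bracket x0 x1) =
           - B x1 (bracket x0 x2) + B x0 (bracket x1 x2) + B x0 (bracket x2 x1)"
  shows "Lstar bracket a (B b) + (- Rstar bracket b (B a) - Lstar bracket b (B a))
    = B (bracket a b)"
proof
  fix y
  have "B (bracket a b) y = B y (bracket a b)"
    by (rule nondegenerate_form_eval(2)[OF assms(1)])
  then show "(Lstar bracket a (B b) + (- Rstar bracket b (B a) - Lstar bracket b (B a))) y
      = B (bracket a b) y"
    using assms(2)[rule_format, of y a b] by (simp add: Lstar_def Rstar_def)
qed

lemma dual_map_form:
  assumes "\<forall>x0 x1. B (N x0) x1 = B x0 (N x1)"
  shows "dual_map N (B a) = B (N a)"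
  using assms by (simp add: dual_map_def fun_eq_iff)

text \<open>The invariance condition rewrites \<open>\<rho>\<^sup>L(N a) (B b)\<close> as \<open>B [N a, b]\<close> and \<open>\<rho>\<^sup>R(N b) (B a)\<close> as
  \<open>B [a, N b]\<close>, each up to a correction term that contains \<open>N\<close> outside the bracket. The third
  condition of a \<open>\<B>N\<close>-structure evaluates the sum of the two corrections as \<open>- B (N [a,b])\<close>.\<close>

lemma dual_regular_sum_form_Nijenhuis:
  assumes "BN_structure scale bracket B N"
  shows "Lstar bracket (N a) (B b) + (- Rstar bracket (N b) (B a) - Lstar bracket (N b) (B a))
    = B (bracket (N a) b) + B (bracket a (N b)) - B (N (bracket a b))"
proof
  fix y
  have B: "nondegenerate_symmetric_form scale B"
    and inv: "B x2 (bracket x0 x1) =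
        - B x1 (bracket x0 x2) + B x0 (bracket x1 x2) + B x0 (bracket x2 x1)"
    and symN: "B (N x0) x1 = B x0 (N x1)"
    and invN: "B x2 (N (bracket x0 x1)) =
        - B x1 (N (bracket x0 x2)) + B x0 (N (bracket x1 x2)) + B x0 (N (bracket x2 x1))"
    for x0 x1 x2
    using assms unfolding BN_structure_def by blast+
  have sym: "B x y = B y x" for x y by (rule nondegenerate_form_eval(2)[OF B])
  show "(Lstar bracket (N a) (B b) + (- Rstar bracket (N b) (B a) - Lstar bracket (N b) (B a))) y
    = (B (bracket (N a) b) + B (bracket a (N b)) - B (N (bracket a b))) y"
    using inv[of y "N a" b] inv[of y a "N b"] invN[of y a b]
    by (simp add: Lstar_def Rstar_def symN sym[of _ y])
qed

end

theorem theorem6p8: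
  fixes scale :: "'k::field_char_0 \<Rightarrow> 'g::ab_group_add \<Rightarrow> 'g"
    and bracket :: "'g \<Rightarrow> 'g \<Rightarrow> 'g"
    and B :: "'g \<Rightarrow> 'g \<Rightarrow> 'k"
    and N :: "'g \<Rightarrow> 'g"
  assumes "leibniz_algebra scale bracket"
    and "nijenhuis_operator scale bracket N"
    and "nondegenerate_symmetric_form scale B"
    and "\<forall>x0 x1 x2. B x2 (bracket x0 x1) =
           - B x1 (bracket x0 x2) + B x0 (bracket x1 x2) + B x0 (bracket x2 x1)"
    and "BN_structure scale bracket B N"
  shows "dual_ON_structure scale bracket fun_scale (dual_space scale)
           (Lstar bracket) (\<lambda>x \<alpha>. - Rstar bracket x \<alpha> - Lstar bracket x \<alpha>)
           (sharp B) (dual_map N) N"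
proof -
  interpret leibniz_algebra scale bracket by (rule assms(1))
  let ?\<rho>R = "\<lambda>x \<alpha>. - Rstar bracket x \<alpha> - Lstar bracket x \<alpha>"
  have linN: "Vector_Spaces.linear scale scale N"
    using assms(2) by (simp add: nijenhuis_operator_def)
  have symN: "\<forall>x0 x1. B (N x0) x1 = B x0 (N x1)"
    using assms(5) by (simp add: BN_structure_def)
  have dual: "dual_space scale = range B"
    using nondegenerate_form_onto_dual_space[OF finite_dim assms(3)] by simp
  have sharp: "sharp B (B a) = a" for a
    unfolding sharp_def using inj_nondegenerate_form[OF assms(3)] by simp
  note formB = nondegenerate_form_eval[OF assms(3)]
  note SB = dual_map_form[OF symN]
  have K_bracket_form: "K_bracket (Lstar bracket) ?\<rho>R (sharp B) (B a) (B b) = B (bracket a b)" for a b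
    using dual_regular_sum_form[OF assms(3,4)] by (simp add: K_bracket_def sharp)
  have linK: "linear_on fun_scale scale (dual_space scale) UNIV (sharp B)"
    by (auto simp: linear_on_def dual sharp simp flip: formB(3,5))
  have "O_operator scale bracket fun_scale (dual_space scale) (Lstar bracket) ?\<rho>R (sharp B)"
    unfolding O_operator_def using linK by (auto simp: dual K_bracket_form sharp)
  moreover have "\<rho> (N y) (dual_map N \<alpha>) = dual_map N (\<rho> (N y) \<alpha>)
      + \<rho> y (dual_map N (dual_map N \<alpha>)) - dual_map N (\<rho> y (dual_map N \<alpha>))"
    if "\<rho> \<in> {Lstar bracket, ?\<rho>R}" "\<alpha> \<in> dual_space scale" for \<rho> y \<alpha>
    using that(1) dual_map_compatible_with_stars[OF assms(2) that(2), of y]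
    by (auto simp: fun_eq_iff dual_map_def)
  moreover have "N (sharp B \<alpha>) = sharp B (dual_map N \<alpha>)" if "\<alpha> \<in> dual_space scale" for \<alpha>
    using that by (auto simp: dual SB sharp)
  moreover have "Lstar bracket (N (sharp B \<alpha>)) \<beta> + ?\<rho>R (N (sharp B \<beta>)) \<alpha> =
      K_bracket (Lstar bracket) ?\<rho>R (sharp B) (dual_map N \<alpha>) \<beta>
      + K_bracket (Lstar bracket) ?\<rho>R (sharp B) \<alpha> (dual_map N \<beta>)
      - dual_map N (K_bracket (Lstar bracket) ?\<rho>R (sharp B) \<alpha> \<beta>)"
    if functionals: "\<alpha> \<in> dual_space scale" "\<beta> \<in> dual_space scale" for \<alpha> \<beta>
  proof -
    obtain a b where "\<alpha> = B a" "\<beta> = B b" using functionals by (auto simp: dual)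
    then show ?thesis
      using dual_regular_sum_form_Nijenhuis[OF assms(5), of a b]
      by (simp only: sharp SB K_bracket_form)
  qed
  ultimately show ?thesis
    unfolding dual_ON_structure_def
    using dual_regular_representation linear_on_dual_map[OF linN] assms(2) by blast
qed

end
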